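(* The configuration space $\mathcal{M}(n,2;\mathbb{P}(V_+))$ of ordered pairs of distinct points of $\mathbb{P}(V_+)\subset\mathbb{H}\mathbb{P}^n$ modulo the diagonal action of $\mathrm{PSp}(n,1)$, with the quotient topology, is homeomorphic to $\mathbb{R}^{\ge}=\{t\in\mathbb{R}:t\ge 0\}$.
   Context: $n$ is a positive integer. $\mathbb{H}$ denotes the quaternions. $\mathbb{H}^{n,1}$ is the right $\mathbb{H}$-vector space $\mathbb{H}^{n+1}$ with the Hermitian product $\langle\mathbf{z},\mathbf{w}\rangle=\mathbf{w}^*J\mathbf{z}$, $J=\mathrm{diag}(1,\dots,1,-1)$. $\mathrm{Sp}(n,1)=\{g\in\mathrm{GL}(n+1,\mathbb{H}):g^*Jg=J\}$, and $\mathrm{PSp}(n,1)=\mathrm{Sp}(n,1)/\{\pm I\}$ acts on the right projective space $\mathbb{H}\mathbb{P}^n$. $V_+$ is the set of vectors $\mathbf{z}\in\mathbb{H}^{n,1}$ with $\langle\mathbf{z},\mathbf{z}\rangle>0$ and $\mathbb{P}(V_+)$ its image in $\mathbb{H}\mathbb{P}^n$.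
   Formalization: The formal theorem assumes n ≥ 2 instead of n a positive integer; for n = 1 the claim is false, since the invariant |⟨z,w⟩|²/(⟨z,z⟩⟨w,w⟩) of distinct points then takes exactly the values t > 1, so the configuration space is an open half-line, not homeomorphic to [0,∞). *)

theory Defs
  imports "HOL-Analysis.Analysis" "HOL-Algebra.Group_Action" "HOL-Algebra.Coset"
begin

section \<open>The quaternions\<close>

datatype quat = Quat (q_re: real) (q_i: real) (q_j: real) (q_k: real)

lemma quat_eq_iff:
  "x = y \<longleftrightarrow> q_re x = q_re y \<and> q_i x = q_i y \<and> q_j x = q_j y \<and> q_k x = q_k y"
  by (cases x; cases y) auto

instantiation quat :: ab_group_add
begin

definition "0 = Quat 0 0 0 0"
definition "x + y = Quat (q_re x + q_re y) (q_i x + q_i y) (q_j x + q_j y) (q_k x + q_k y)"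
definition "- x = Quat (- q_re x) (- q_i x) (- q_j x) (- q_k x)"
definition "x - y = Quat (q_re x - q_re y) (q_i x - q_i y) (q_j x - q_j y) (q_k x - q_k y)"

instance
  by standard
    (simp_all add: quat_eq_iff zero_quat_def plus_quat_def uminus_quat_def minus_quat_def)

end

lemma quat_add_simps [simp]:
  "q_re 0 = 0" "q_i 0 = 0" "q_j 0 = 0" "q_k 0 = 0"
  "q_re (x + y) = q_re x + q_re y" "q_i (x + y) = q_i x + q_i y"
  "q_j (x + y) = q_j x + q_j y" "q_k (x + y) = q_k x + q_k y"
  "q_re (- x) = - q_re x" "q_i (- x) = - q_i x" "q_j (- x) = - q_j x" "q_k (- x) = - q_k x"
  "q_re (x - y) = q_re x - q_re y" "q_i (x - y) = q_i x - q_i y"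
  "q_j (x - y) = q_j x - q_j y" "q_k (x - y) = q_k x - q_k y"
  by (simp_all add: zero_quat_def plus_quat_def uminus_quat_def minus_quat_def)

instantiation quat :: real_vector
begin

definition "scaleR r x = Quat (r * q_re x) (r * q_i x) (r * q_j x) (r * q_k x)"

instance
  by standard (simp_all add: quat_eq_iff scaleR_quat_def algebra_simps)

end

lemma quat_scaleR_simps [simp]:
  "q_re (r *\<^sub>R x) = r * q_re x" "q_i (r *\<^sub>R x) = r * q_i x"
  "q_j (r *\<^sub>R x) = r * q_j x" "q_k (r *\<^sub>R x) = r * q_k x"
  by (simp_all add: scaleR_quat_def)

instantiation quat :: real_algebra_1
begin

definition "1 = Quat 1 0 0 0"

definition "x * y = Quat
  (q_re x * q_re y - q_i x * q_i y - q_j x * q_j y - q_k x * q_k y)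
  (q_re x * q_i y + q_i x * q_re y + q_j x * q_k y - q_k x * q_j y)
  (q_re x * q_j y - q_i x * q_k y + q_j x * q_re y + q_k x * q_i y)
  (q_re x * q_k y + q_i x * q_j y - q_j x * q_i y + q_k x * q_re y)"

instance
  by standard (simp_all add: quat_eq_iff times_quat_def one_quat_def algebra_simps)

end

lemma quat_mult_simps [simp]:
  "q_re 1 = 1" "q_i 1 = 0" "q_j 1 = 0" "q_k 1 = 0"
  "q_re (x * y) = q_re x * q_re y - q_i x * q_i y - q_j x * q_j y - q_k x * q_k y"
  "q_i (x * y) = q_re x * q_i y + q_i x * q_re y + q_j x * q_k y - q_k x * q_j y"
  "q_j (x * y) = q_re x * q_j y - q_i x * q_k y + q_j x * q_re y + q_k x * q_i y"
  "q_k (x * y) = q_re x * q_k y + q_i x * q_j y - q_j x * q_i y + q_k x * q_re y"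
  by (simp_all add: times_quat_def one_quat_def)

lemma quat_of_real_simps [simp]:
  "q_re (of_real r) = r" "q_i (of_real r) = 0" "q_j (of_real r) = 0" "q_k (of_real r) = 0"
  by (simp_all add: of_real_def)

definition q_cnj :: "quat \<Rightarrow> quat" where
  "q_cnj x = Quat (q_re x) (- q_i x) (- q_j x) (- q_k x)"

lemma q_cnj_simps [simp]:
  "q_re (q_cnj x) = q_re x" "q_i (q_cnj x) = - q_i x"
  "q_j (q_cnj x) = - q_j x" "q_k (q_cnj x) = - q_k x"
  by (simp_all add: q_cnj_def)

lemma q_cnj_add: "q_cnj (x + y) = q_cnj x + q_cnj y"
  and q_cnj_mult: "q_cnj (x * y) = q_cnj y * q_cnj x"
  and q_cnj_cnj [simp]: "q_cnj (q_cnj x) = x"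
  and q_cnj_0 [simp]: "q_cnj 0 = 0"
  and q_cnj_1 [simp]: "q_cnj 1 = 1"
  and q_cnj_minus: "q_cnj (- x) = - q_cnj x"
  by (simp_all add: quat_eq_iff algebra_simps)

lemma q_cnj_sum: "q_cnj (sum f A) = (\<Sum>i\<in>A. q_cnj (f i))"
  by (induction A rule: infinite_finite_induct) (simp_all add: q_cnj_add)

text \<open>The norm below is the Euclidean norm of \<open>\<real>\<^sup>4\<close>; it supplies the topology.\<close>

instantiation quat :: real_inner
begin

definition inner_quat_def:
  "inner x y = q_re x * q_re y + q_i x * q_i y + q_j x * q_j y + q_k x * q_k y"
definition norm_quat_def: "norm (x::quat) = sqrt (inner x x)"
definition sgn_quat_def: "sgn (x::quat) = x /\<^sub>R norm x"
definition dist_quat_def: "dist x (y::quat) = norm (x - y)"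
definition uniformity_quat_def [code del]:
  "(uniformity :: (quat \<times> quat) filter) = (INF e\<in>{0 <..}. principal {(x, y). dist x y < e})"
definition open_quat_def [code del]:
  "open (U :: quat set) \<longleftrightarrow> (\<forall>x\<in>U. eventually (\<lambda>(x', y). x' = x \<longrightarrow> y \<in> U) uniformity)"

instance
proof
  fix x y z :: quat and r :: real
  show "inner x y = inner y x" "inner (x + y) z = inner x z + inner y z"
    "inner (r *\<^sub>R x) y = r * inner x y" "0 \<le> inner x x"
    by (simp_all add: inner_quat_def algebra_simps)
  have "a * a + b * b + c * c + d * d = 0 \<longleftrightarrow> a = 0 \<and> b = 0 \<and> c = 0 \<and> d = 0"
    for a b c d :: real
    by (simp add: add_nonneg_eq_0_iff)
  then show "inner x x = 0 \<longleftrightarrow> x = 0"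
    by (simp add: inner_quat_def quat_eq_iff)
qed (rule norm_quat_def sgn_quat_def dist_quat_def uniformity_quat_def open_quat_def)+

end

instantiation quat :: real_normed_div_algebra
begin

definition "inverse x = q_cnj x /\<^sub>R (inner x x)"
definition "x div (y::quat) = x * inverse y"

instance
proof
  fix x y :: quat
  show "inverse (0::quat) = 0" "x div y = x * inverse y"
    by (simp_all add: inverse_quat_def divide_quat_def)
  have *: "x * q_cnj x = of_real (inner x x)" "q_cnj x * x = of_real (inner x x)"
    by (simp_all add: quat_eq_iff inner_quat_def)
  show "inverse x * x = 1" "x * inverse x = 1" if "x \<noteq> 0"
    using that by (simp_all add: inverse_quat_def * of_real_def)
  have "inner (x * y) (x * y) = inner x x * inner y y"
    by (simp add: inner_quat_def algebra_simps)
  then show "norm (x * y) = norm x * norm y"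
    by (simp add: norm_quat_def real_sqrt_mult)
qed

end


section \<open>Quotient topologies\<close>

definition quotient_topology :: "'a topology \<Rightarrow> ('a \<Rightarrow> 'b) \<Rightarrow> 'b topology" where
  "quotient_topology X f =
     topology (\<lambda>U. U \<subseteq> f ` topspace X \<and> openin X {x \<in> topspace X. f x \<in> U})"

lemma openin_quotient_topology:
  "openin (quotient_topology X f) U \<longleftrightarrow>
     U \<subseteq> f ` topspace X \<and> openin X {x \<in> topspace X. f x \<in> U}"
proof -
  let ?P = "\<lambda>U. U \<subseteq> f ` topspace X \<and> openin X {x \<in> topspace X. f x \<in> U}"
  have "?P (S \<inter> T)" if "?P S" "?P T" for S T
  proof -
    have "{x \<in> topspace X. f x \<in> S \<inter> T} =
        {x \<in> topspace X. f x \<in> S} \<inter> {x \<in> topspace X. f x \<in> T}" by auto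
    with that show ?thesis by auto
  qed
  moreover have "?P (\<Union>K)" if "\<forall>S\<in>K. ?P S" for K
  proof -
    have "{x \<in> topspace X. f x \<in> \<Union>K} = (\<Union>S\<in>K. {x \<in> topspace X. f x \<in> S})" by auto
    with that show ?thesis by auto
  qed
  ultimately have "istopology ?P"
    unfolding istopology_def by blast
  then show ?thesis
    by (simp add: quotient_topology_def topology_inverse')
qed

lemma topspace_quotient_topology [simp]:
  "topspace (quotient_topology X f) = f ` topspace X"
proof -
  have "{x \<in> topspace X. f x \<in> f ` topspace X} = topspace X" by auto
  then have "openin (quotient_topology X f) (f ` topspace X)"
    by (simp add: openin_quotient_topology)
  then show ?thesis
    by (metis openin_quotient_topology openin_subset openin_topspace subset_antisym)
qed

lemma quotient_map_quotient_topology: "quotient_map X (quotient_topology X f) f"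
  by (auto simp: quotient_map_def openin_quotient_topology)


section \<open>The Hermitian space of signature (n,1) and its isometry group\<close>

text \<open>
  Throughout, \<open>n = CARD('n)\<close>. The \<open>n + 1\<close> coordinates are indexed by \<^typ>\<open>'n option\<close>, where
  \<^term>\<open>None\<close> is the negative coordinate.
\<close>

type_synonym 'n hvec = "quat ^ ('n option)"
type_synonym 'n hmat = "quat ^ ('n option) ^ ('n option)"

definition rscale :: "'n::finite hvec \<Rightarrow> quat \<Rightarrow> 'n hvec" where
  "rscale z q = (\<chi> i. z $ i * q)"

definition adjoint_mat :: "'n::finite hmat \<Rightarrow> 'n hmat" where
  "adjoint_mat A = (\<chi> i j. q_cnj (A $ j $ i))"

definition Jmat :: "'n::finite hmat" where
  "Jmat = (\<chi> i j. if i = j then (if i = None then - 1 else 1) else 0)"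

definition hform :: "'n::finite hvec \<Rightarrow> 'n hvec \<Rightarrow> quat" where
  "hform z w = (\<Sum>i\<in>UNIV. q_cnj (w $ i) * (Jmat *v z) $ i)"

definition Sp :: "'n::finite itself \<Rightarrow> 'n hmat monoid" where
  "Sp _ = \<lparr>carrier = {g. invertible g \<and> adjoint_mat g ** Jmat ** g = Jmat},
           mult = (**), one = mat 1\<rparr>"

lemma hform_self_real: "hform z z \<in> \<real>"
proof -
  have J: "Jmat *v z = (\<chi> i. if i = None then - z $ i else z $ i)"
    by (simp add: vec_eq_iff Jmat_def matrix_vector_mult_def if_distrib[of "\<lambda>x. x * _"]
        cong: if_cong)
  have "q_cnj x * x = of_real (inner x x)" for x
    by (simp add: quat_eq_iff inner_quat_def)
  then show ?thesis
    by (auto simp: hform_def J intro!: sum_in_Reals)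
qed

lemma adjoint_mat_mult: "adjoint_mat (A ** B) = adjoint_mat B ** adjoint_mat A"
  by (simp add: adjoint_mat_def matrix_matrix_mult_def vec_eq_iff q_cnj_sum q_cnj_mult)

lemma adjoint_mat_1 [simp]: "adjoint_mat (mat 1) = mat 1"
  by (auto simp: adjoint_mat_def mat_def vec_eq_iff)

lemma hmat_minus_mult: "(- A) ** B = - (A ** B)" "A ** (- B) = - (A ** B)"
  for A B :: "'n::finite hmat"
  by (simp_all add: matrix_matrix_mult_def vec_eq_iff sum_negf)

lemma group_Sp: "group (Sp T)"
proof (rule groupI)
  fix x y assume xy: "x \<in> carrier (Sp T)" "y \<in> carrier (Sp T)"
  have "adjoint_mat (x ** y) ** Jmat ** (x ** y) =
      adjoint_mat y ** (adjoint_mat x ** Jmat ** x) ** y"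
    by (simp add: adjoint_mat_mult matrix_mul_assoc)
  with xy show "x \<otimes>\<^bsub>Sp T\<^esub> y \<in> carrier (Sp T)"
    by (simp add: Sp_def invertible_mult)
next
  fix x assume x: "x \<in> carrier (Sp T)"
  then obtain y where y: "x ** y = mat 1" "y ** x = mat 1"
    by (auto simp: Sp_def invertible_def)
  have "adjoint_mat y ** Jmat ** y =
      adjoint_mat y ** (adjoint_mat x ** Jmat ** x) ** y"
    using x by (simp add: Sp_def)
  also have "\<dots> = adjoint_mat (x ** y) ** Jmat ** (x ** y)"
    by (simp add: adjoint_mat_mult matrix_mul_assoc)
  finally have "adjoint_mat y ** Jmat ** y = Jmat"
    by (simp add: y)
  then show "\<exists>y\<in>carrier (Sp T). y \<otimes>\<^bsub>Sp T\<^esub> x = \<one>\<^bsub>Sp T\<^esub>"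
    using y by (auto simp: Sp_def invertible_def intro!: bexI[of _ y])
qed (auto simp: Sp_def matrix_mul_assoc invertible_def intro!: exI[of _ "mat 1"])

lemma minus_1_in_Sp: "- mat 1 \<in> carrier (Sp (T :: 'n::finite itself))"
proof -
  have "adjoint_mat (- mat 1 :: 'n hmat) = - mat 1"
    by (auto simp: adjoint_mat_def mat_def vec_eq_iff q_cnj_minus)
  then have "adjoint_mat (- mat 1) ** Jmat ** - mat 1 = (Jmat :: 'n hmat)"
    by (simp only: hmat_minus_mult matrix_mul_lid matrix_mul_rid minus_minus)
  moreover have "invertible (- mat 1 :: 'n hmat)"
    unfolding invertible_def by (intro exI[of _ "- mat 1"]) (simp add: hmat_minus_mult)
  ultimately show ?thesis
    by (simp add: Sp_def)
qed

lemma Sp_center_normal: "{mat 1, - mat 1} \<lhd> Sp T"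
proof -
  interpret group "Sp T" by (rule group_Sp)
  have inv: "inv\<^bsub>Sp T\<^esub> (- mat 1) = - mat 1"
    by (rule inv_equality) (use minus_1_in_Sp[of T] in \<open>auto simp: Sp_def hmat_minus_mult\<close>)
  have one: "\<one>\<^bsub>Sp T\<^esub> = mat 1" "mat 1 \<in> carrier (Sp T)"
    using one_closed by (simp_all add: Sp_def)
  have "subgroup {mat 1, - mat 1} (Sp T)"
  proof (rule subgroupI)
    show "inv\<^bsub>Sp T\<^esub> a \<in> {mat 1, - mat 1}" if "a \<in> {mat 1, - mat 1}" for a
      using that inv inv_one one by auto
  qed (use one minus_1_in_Sp[of T] in \<open>auto simp: Sp_def hmat_minus_mult\<close>)
  moreover have "{mat 1, - mat 1} #>\<^bsub>Sp T\<^esub> x = x <#\<^bsub>Sp T\<^esub> {mat 1, - mat 1}" for x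
    by (auto simp: r_coset_def l_coset_def Sp_def hmat_minus_mult)
  ultimately show ?thesis
    by (auto intro: normalI)
qed

definition PSp :: "'n::finite itself \<Rightarrow> 'n hmat set monoid" where
  "PSp T = Sp T Mod {mat 1, - mat 1}"


section \<open>Projective space and the configuration space\<close>

text \<open>A point of projective space is a right line through the origin with the origin removed.\<close>

definition proj :: "'n::finite hvec \<Rightarrow> 'n hvec set" where
  "proj z = {rscale z q | q. q \<noteq> 0}"

definition HP_top :: "'n::finite itself \<Rightarrow> 'n hvec set topology" where
  "HP_top _ = quotient_topology (top_of_set (- {0})) proj"

definition V_plus :: "'n::finite hvec set" where
  "V_plus = {z. \<exists>r>0. hform z z = of_real r}"

definition PV_plus_top :: "'n::finite itself \<Rightarrow> 'n hvec set topology" where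
  "PV_plus_top T = subtopology (HP_top T) (proj ` V_plus)"

text \<open>
  An element of \<^const>\<open>PSp\<close> is a coset \<open>{g, - g}\<close>; both representatives send a point of
  projective space to the same point, see \<open>PSp_act_coset\<close> below.
\<close>

definition PSp_act :: "'n::finite hmat set \<Rightarrow> 'n hvec set \<Rightarrow> 'n hvec set" where
  "PSp_act C p = (\<Union>g\<in>C. (\<lambda>z. g *v z) ` p)"

lemma mult_rscale: "g *v rscale z q = rscale (g *v z) q"
  by (simp add: rscale_def matrix_vector_mult_def vec_eq_iff sum_distrib_right mult.assoc)

lemma image_proj: "(\<lambda>z. g *v z) ` proj z = proj (g *v z)"
  by (auto simp: proj_def mult_rscale image_iff) (metis mult_rscale)

lemma PSp_act_coset:
  assumes "g \<in> carrier (Sp TYPE('n::finite))"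
  shows "PSp_act ({mat 1, - mat 1} #>\<^bsub>Sp TYPE('n)\<^esub> g) (proj z) = proj (g *v z)"
proof -
  have coset: "{mat 1, - mat 1} #>\<^bsub>Sp TYPE('n)\<^esub> g = {g, - g}"
    by (auto simp: r_coset_def Sp_def hmat_minus_mult)
  have minus: "(- g) *v z = rscale (g *v z) (- 1)"
    by (simp add: rscale_def matrix_vector_mult_def vec_eq_iff sum_negf)
  have rs: "rscale (rscale w a) b = rscale w (a * b)" for w :: "'n hvec" and a b
    by (simp add: rscale_def vec_eq_iff mult.assoc)
  have "proj (rscale w (- 1)) = proj w" for w :: "'n hvec"
  proof -
    have "\<exists>q'. rscale w q = rscale w (- q') \<and> q' \<noteq> 0" if "q \<noteq> 0" for q
      using that by (intro exI[of _ "- q"]) simp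
    moreover have "\<exists>q'. rscale w (- q) = rscale w q' \<and> q' \<noteq> 0" if "q \<noteq> 0" for q
      using that by (intro exI[of _ "- q"]) simp
    ultimately show ?thesis
      unfolding proj_def rs by auto
  qed
  then show ?thesis
    by (simp add: PSp_act_def coset image_proj minus)
qed

definition PSp_act2 ::
    "'n::finite hmat set \<Rightarrow> 'n hvec set \<times> 'n hvec set \<Rightarrow> 'n hvec set \<times> 'n hvec set" where
  "PSp_act2 C = (\<lambda>(p, q). (PSp_act C p, PSp_act C q))"

definition pairs_top :: "'n::finite itself \<Rightarrow> ('n hvec set \<times> 'n hvec set) topology" where
  "pairs_top T = subtopology (prod_topology (PV_plus_top T) (PV_plus_top T)) {(p, q). p \<noteq> q}"

text \<open>
  The homeomorphism type of the space below depends on whether \<open>n = 1\<close>. Two distinct points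
  \<open>[z], [w]\<close> have the invariant \<open>t = |\<langle>z,w\<rangle>|\<^sup>2 / (\<langle>z,z\<rangle> \<langle>w,w\<rangle>)\<close>, which for
  \<open>n \<ge> 2\<close> takes all values in \<open>[0,\<infinity>)\<close>. For \<open>n = 1\<close> the vectors \<open>z, w\<close> are a basis of the
  whole space, whose form has signature (1,1), so \<open>t > 1\<close>: the space is then an open
  half-line, which is not homeomorphic to \<open>[0,\<infinity>)\<close>.
\<close>

definition config_top :: "'n::finite itself \<Rightarrow> ('n hvec set \<times> 'n hvec set) set topology" where
  "config_top T = quotient_topology (pairs_top T) (orbit (PSp T) PSp_act2)"

end

theory Submission
  imports Defs
begin

text \<open>
  The invariant \<open>t([z],[w]) = |\<langle>z,w\<rangle>|\<^sup>2 / (\<langle>z,z\<rangle> \<langle>w,w\<rangle>)\<close> is continuous on pairs of distinct positive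
  points because the projection to projective space is open, and it has a continuous section
  defined on \<open>[0,\<infinity>)\<close>. A continuous map with a continuous section is a quotient map, so it is
  enough that its fibres are the orbits. Normalising representatives so that \<open>z, w\<close> have norm 1
  and \<open>\<langle>w,z\<rangle> = \<surd>t\<close>, this is a case of Witt's theorem: \<open>z\<close> is moved to a fixed basis vector \<open>e\<close>,
  then the component of \<open>w\<close> orthogonal to \<open>e\<close> is moved within the orthogonal complement of \<open>e\<close>.
  Both steps are products of at most two quasi-reflections \<open>x \<mapsto> x - a \<langle>u,a\<rangle>\<^sup>-\<^sup>1 \<langle>x,a\<rangle>\<close>, \<open>a = u - v\<close>,
  which send \<open>u\<close> to \<open>v\<close> whenever \<open>\<langle>u,u\<rangle> = \<langle>v,v\<rangle>\<close> and \<open>\<langle>u,a\<rangle> \<noteq> 0\<close>, and fix all vectors orthogonal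
  to \<open>a\<close>.
\<close>

section \<open>Isometries of the Hermitian form\<close>

lemma cnj_mult_self: "q_cnj x * x = of_real (inner x x)" "x * q_cnj x = of_real (inner x x)"
  by (simp_all add: quat_eq_iff inner_quat_def)

lemma norm_q_cnj [simp]: "norm (q_cnj x) = norm x"
  by (simp add: norm_quat_def inner_quat_def)

lemma q_cnj_diff: "q_cnj (x - y) = q_cnj x - q_cnj y"
  by (simp add: quat_eq_iff)

lemma q_cnj_of_real [simp]: "q_cnj (of_real r) = of_real r"
  by (simp add: quat_eq_iff)

lemma of_real_commute_quat: "of_real r * x = x * of_real r" for x :: quat
  by (simp add: quat_eq_iff)

lemma bounded_linear_q_cnj: "bounded_linear q_cnj"
  by (rule bounded_linear_intro[where K = 1]) (simp_all add: quat_eq_iff)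

lemma bounded_linear_q_re: "bounded_linear q_re"
proof -
  have "q_re = (\<lambda>x. inner x 1)"
    by (simp add: fun_eq_iff inner_quat_def)
  then show ?thesis
    using bounded_linear_inner_left[of "1::quat"] by (simp only:)
qed

lemmas continuous_on_q_cnj [continuous_intros] =
  bounded_linear.continuous_on[OF bounded_linear_q_cnj]
lemmas continuous_on_q_re [continuous_intros] =
  bounded_linear.continuous_on[OF bounded_linear_q_re]

lemma Jmat_nth: "(Jmat *v z) $ i = (if i = None then - z $ i else z $ i)"
  by (simp add: Jmat_def matrix_vector_mult_def if_distrib[of "\<lambda>x. x * _"] cong: if_cong)

lemma hform_alt: "hform z w = (\<Sum>i\<in>UNIV. q_cnj (w $ i) * (if i = None then - z $ i else z $ i))"
  by (simp add: hform_def Jmat_nth)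

lemma hform_option:
  "hform z w = (\<Sum>i\<in>UNIV. q_cnj (w $ Some i) * z $ Some i) - q_cnj (w $ None) * z $ None"
  by (simp add: hform_alt UNIV_option_conv sum.reindex)

lemma hform_add_left: "hform (x + y) w = hform x w + hform y w"
  by (simp add: hform_option algebra_simps sum.distrib)

lemma hform_diff_left: "hform (x - y) w = hform x w - hform y w"
  by (simp add: hform_option algebra_simps sum_subtractf)

lemma hform_rscale_left: "hform (rscale x q) w = hform x w * q"
  by (simp add: hform_option rscale_def algebra_simps sum_distrib_left sum_distrib_right)

lemma hform_cnj: "q_cnj (hform z w) = hform w z"
  by (simp add: hform_option q_cnj_diff q_cnj_sum q_cnj_mult)

lemma hform_add_right: "hform w (x + y) = hform w x + hform w y"
  by (metis hform_cnj hform_add_left q_cnj_add)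

lemma hform_diff_right: "hform w (x - y) = hform w x - hform w y"
  by (metis hform_cnj hform_diff_left q_cnj_diff)

lemma hform_rscale_right: "hform w (rscale x q) = q_cnj q * hform w x"
  by (metis hform_cnj hform_rscale_left q_cnj_mult)

lemma hform_zero [simp]: "hform 0 w = 0" "hform w 0 = 0"
  by (simp_all add: hform_option)

lemma hform_minus [simp]: "hform (- x) w = - hform x w" "hform w (- x) = - hform w x"
  using hform_diff_left[of 0 x w] hform_diff_right[of w 0 x] by simp_all

lemmas hform_linear = hform_add_left hform_add_right hform_diff_left hform_diff_right
  hform_rscale_left hform_rscale_right

lemma hform_self: "hform z z = of_real (q_re (hform z z))"
  using hform_self_real[of z] by (auto simp: Reals_def)

lemma rscale_rscale [simp]: "rscale (rscale w a) b = rscale w (a * b)"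
  by (simp add: rscale_def vec_eq_iff mult.assoc)

lemma rscale_1 [simp]: "rscale w 1 = w"
  by (simp add: rscale_def vec_eq_iff)

lemma rscale_0 [simp]: "rscale 0 q = 0" "rscale w 0 = 0"
  by (simp_all add: rscale_def vec_eq_iff)

lemma rscale_diff_right: "rscale w (p - q) = rscale w p - rscale w q"
  by (simp add: rscale_def vec_eq_iff algebra_simps)

lemma sum_axis_cnj: "(\<Sum>i\<in>UNIV. q_cnj (axis k (1::quat) $ i) * f i) = f k"
  by (simp add: axis_def if_distrib[of q_cnj] if_distrib[of "\<lambda>x. x * _"] cong: if_cong)

lemma adjoint_mat_dual:
  "(\<Sum>i\<in>UNIV. q_cnj ((g *v w) $ i) * v $ i) = (\<Sum>i\<in>UNIV. q_cnj (w $ i) * (adjoint_mat g *v v) $ i)"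
  by (simp add: matrix_vector_mult_def adjoint_mat_def q_cnj_sum q_cnj_mult sum_distrib_left
      sum_distrib_right mult.assoc) (rule sum.swap)

lemma hform_matrix: "hform (g *v z) (g *v w) =
    (\<Sum>i\<in>UNIV. q_cnj (w $ i) * ((adjoint_mat g ** Jmat ** g) *v z) $ i)"
  unfolding hform_def adjoint_mat_dual by (simp add: matrix_vector_mul_assoc matrix_mul_assoc)

lemma Sp_iff:
  "g \<in> carrier (Sp T) \<longleftrightarrow> invertible g \<and> (\<forall>z w. hform (g *v z) (g *v w) = hform z w)"
proof -
  have "adjoint_mat g ** Jmat ** g = Jmat" if *: "\<And>z w. hform (g *v z) (g *v w) = hform z w"
    unfolding matrix_eq
  proof (rule allI, rule vec_eq_iff[THEN iffD2], rule allI)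
    fix z k
    show "((adjoint_mat g ** Jmat ** g) *v z) $ k = (Jmat *v z) $ k"
      \<comment> \<open>Pairing with axis vectors in the second slot reads off coordinates.\<close>
      using *[of z "axis k 1", unfolded hform_matrix, unfolded hform_def sum_axis_cnj] .
  qed
  moreover have "hform (g *v z) (g *v w) = hform z w" if "adjoint_mat g ** Jmat ** g = Jmat" for z w
    unfolding hform_matrix that by (rule hform_def[symmetric])
  ultimately show ?thesis
    by (auto simp: Sp_def)
qed

lemma hform_Sp: "g \<in> carrier (Sp T) \<Longrightarrow> hform (g *v z) (g *v w) = hform z w"
  by (simp add: Sp_iff)

text \<open>The matrix of the quasi-reflection \<open>x \<mapsto> x - a q \<langle>x,a\<rangle>\<close>; the vector \<open>a\<close> may be isotropic.\<close>

definition qrefl :: "'n::finite hvec \<Rightarrow> quat \<Rightarrow> 'n hmat" where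
  "qrefl a q = (\<chi> i j. (if i = j then 1 else 0) -
    a $ i * q * (if j = None then - q_cnj (a $ j) else q_cnj (a $ j)))"

lemma qrefl_mult: "qrefl a q *v x = x - rscale a (q * hform x a)"
proof (rule vec_eq_iff[THEN iffD2], rule allI)
  fix i
  have "(qrefl a q *v x) $ i = (\<Sum>j\<in>UNIV. (if i = j then x $ j else 0)) -
      (\<Sum>j\<in>UNIV. a $ i * q * (q_cnj (a $ j) * (if j = None then - x $ j else x $ j)))"
    unfolding matrix_vector_mult_def qrefl_def sum_subtractf[symmetric]
    by (auto simp: algebra_simps mult.assoc intro!: sum.cong)
  also have "\<dots> = (x - rscale a (q * hform x a)) $ i"
    by (simp add: hform_alt rscale_def sum_distrib_left mult.assoc)
  finally show "(qrefl a q *v x) $ i = (x - rscale a (q * hform x a)) $ i" .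
qed

text \<open>For \<open>q \<noteq> 0\<close> the condition says that twice the real part of
  \<open>inverse q\<close> is \<open>hform a a\<close>. It turns
  \<open>q_cnj q * hform a a * q\<close> into \<open>q + q_cnj q\<close>, which cancels the
  correction terms in the form.\<close>

lemma qrefl_Sp:
  assumes q: "q + q_cnj q = of_real (inner q q) * hform a a"
  shows "qrefl a q \<in> carrier (Sp T)"
proof -
  obtain r where r: "hform a a = of_real r"
    using hform_self by blast
  have q': "q_cnj q * hform a a * q = q + q_cnj q" "q * hform a a * q_cnj q = q + q_cnj q"
    unfolding q r by (metis cnj_mult_self mult.assoc of_real_commute_quat)+
  \<comment> \<open>The inverse has the conjugate parameter; a general \<open>p\<close> covers both
    orders of multiplication.\<close>
  have inv: "qrefl a p ** qrefl a (q_cnj p) = mat 1" if p: "p * hform a a * q_cnj p = p + q_cnj p" for p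
  proof (unfold matrix_eq, rule allI)
    fix x
    have "(qrefl a p ** qrefl a (q_cnj p)) *v x
        = x - rscale a (q_cnj p * hform x a) - rscale a (p * hform x a - p * hform a a * q_cnj p * hform x a)"
      by (simp add: qrefl_mult hform_linear rscale_diff_right algebra_simps flip: matrix_vector_mul_assoc)
    also have "\<dots> = mat 1 *v x"
      unfolding p by (simp add: vec_eq_iff rscale_def algebra_simps)
    finally show "(qrefl a p ** qrefl a (q_cnj p)) *v x = mat 1 *v x" .
  qed
  have "invertible (qrefl a q)"
    unfolding invertible_def using inv[of q] inv[of "q_cnj q"] q' by (auto simp: add.commute)
  moreover have "hform (qrefl a q *v z) (qrefl a q *v w) = hform z w" for z w
  proof -
    have "hform (qrefl a q *v z) (qrefl a q *v w) = hform z w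
       + hform a w * (q_cnj q * hform a a * q - q - q_cnj q) * hform z a"
      by (simp add: qrefl_mult hform_linear q_cnj_mult hform_cnj algebra_simps)
    then show ?thesis by (simp add: q')
  qed
  ultimately show ?thesis
    by (simp add: Sp_iff)
qed

text \<open>With \<open>a = u - v\<close> and \<open>h = hform u a\<close>, the parameter
  \<open>inverse h\<close> sends \<open>u\<close> to \<open>u - a\<close>. Equal norms give
  \<open>hform a a = h + q_cnj h\<close>, which is the isometry condition, and \<open>ne\<close>
  makes \<open>h\<close> invertible.\<close>

lemma witt_generic:
  assumes norm: "hform u u = hform v v" and ne: "hform v u \<noteq> hform u u"
  obtains g where "g \<in> carrier (Sp T)" "g *v u = v"
    "\<And>x. hform x u = hform x v \<Longrightarrow> g *v x = x"
proof -
  define h where "h = hform u (u - v)"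
  have "h = q_cnj (hform u u - hform v u)"
    by (simp add: h_def hform_linear q_cnj_diff hform_cnj)
  with ne have h: "h \<noteq> 0"
    by (metis q_cnj_cnj q_cnj_0 right_minus_eq)
  have aa: "hform (u - v) (u - v) = h + q_cnj h"
    unfolding h_def hform_cnj by (simp add: hform_linear norm)
  have inv: "inverse h = q_cnj h /\<^sub>R inner h h" "q_cnj (inverse h) = h /\<^sub>R inner h h"
    by (simp_all add: inverse_quat_def quat_eq_iff)
  have "inner (inverse h) (inverse h) = inverse (inner h h)"
    by (simp add: norm_inverse power_inverse flip: power2_norm_eq_inner)
  moreover have "inverse h + q_cnj (inverse h) = (h + q_cnj h) /\<^sub>R inner h h"
    unfolding inv(2) by (simp only: inv(1) scaleR_add_right add.commute)
  ultimately have "inverse h + q_cnj (inverse h) = of_real (inner (inverse h) (inverse h)) * hform (u - v) (u - v)"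
    by (simp only: aa scaleR_conv_of_real)
  then have "qrefl (u - v) (inverse h) \<in> carrier (Sp T)"
    by (rule qrefl_Sp)
  moreover have "qrefl (u - v) (inverse h) *v u = v"
    using h by (simp add: qrefl_mult flip: h_def)
  moreover have "qrefl (u - v) (inverse h) *v x = x" if "hform x u = hform x v" for x
    using that by (simp add: qrefl_mult hform_linear)
  ultimately show thesis
    by (rule that)
qed

text \<open>The form is positive definite on vectors with vanishing negative coordinate.\<close>

lemma isotropic_None_nonzero:
  assumes "hform y y = 0" "y \<noteq> 0"
  shows "y $ None \<noteq> 0"
proof
  assume 0: "y $ None = 0"
  have "of_real (\<Sum>i\<in>UNIV. inner (y $ Some i) (y $ Some i)) = (0 :: quat)"
    using assms(1) by (simp add: hform_option 0 cnj_mult_self)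
  then have "\<forall>i. y $ Some i = 0"
    by (simp add: sum_nonneg_eq_0_iff del: of_real_sum)
  with 0 have "y = 0"
    by (auto simp: vec_eq_iff) (metis not_Some_eq)
  with assms show False by simp
qed

lemma hform_Jmat: "hform (Jmat *v z) w = hform z (Jmat *v w)"
  by (auto simp: hform_alt Jmat_nth q_cnj_minus intro!: sum.cong)

lemma Jmat_Jmat: "Jmat *v (Jmat *v z) = z"
  by (simp add: vec_eq_iff Jmat_nth)

text \<open>The case \<open>e = 0\<close> is transitivity on nonzero vectors of equal norm.\<close>

lemma witt_fixing:
  fixes y y' e :: "'n::finite hvec"
  assumes norm: "hform y y = hform y' y'" and nz: "y \<noteq> 0" "y' \<noteq> 0"
    and e: "Jmat *v e = e" and orth: "hform y e = 0" "hform y' e = 0"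
  obtains g where "g \<in> carrier (Sp TYPE('n))" "g *v y = y'" "g *v e = e"
proof -
  interpret Sp: group "Sp TYPE('n)"
    by (rule group_Sp)
  note thesis = that
  have orth': "hform e y = 0" "hform e y' = 0"
    by (metis hform_cnj orth q_cnj_0)+
  \<comment> \<open>Since \<open>m\<close> is orthogonal to \<open>e\<close>, the reflections taking
    \<open>y\<close> to \<open>m\<close> and \<open>m\<close> to \<open>y'\<close> both fix
    \<open>e\<close>; the two inequalities keep their parameters invertible.\<close>
  have two_steps: thesis if m: "hform m m = hform y y" "hform e m = 0" "hform m y \<noteq> hform y y"
    "hform y' m \<noteq> hform y y" for m
  proof -
    obtain g where g: "g \<in> carrier (Sp TYPE('n))" "g *v y = m" "g *v e = e"
      using witt_generic[of y m "TYPE('n)"] m orth' by metis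
    obtain h where h: "h \<in> carrier (Sp TYPE('n))" "h *v m = y'" "h *v e = e"
      using witt_generic[of m y' "TYPE('n)"] m orth' norm by metis
    have "h ** g \<in> carrier (Sp TYPE('n))"
      using Sp.m_closed[OF h(1) g(1)] by (simp add: Sp_def)
    then show thesis
      by (rule thesis) (simp_all add: g h flip: matrix_vector_mul_assoc)
  qed
  consider "hform y' y \<noteq> hform y y" | "hform y' y = hform y y" "hform y y \<noteq> 0"
    | "hform y' y = 0" "hform y y = 0"
    by metis
  then show thesis
  proof cases
    case 1
    then show thesis
      using witt_generic[of y y' "TYPE('n)"] norm orth' that by metis
  next
    case 2
    \<comment> \<open>Here \<open>y\<close> is not isotropic, so one can pass through \<open>- y'\<close>.\<close>
    have "- x \<noteq> x" if "x \<noteq> 0" for x :: quat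
      using that by (auto simp: quat_eq_iff)
    with 2 show thesis
      by (intro two_steps[of "- y'"]) (simp_all add: orth' flip: norm)
  next
    case 3
    \<comment> \<open>\<open>y\<close> and \<open>y'\<close> are isotropic and orthogonal; the isotropic vector \<open>J y\<close> is orthogonal to neither.\<close>
    have N: "y $ None \<noteq> 0" "y' $ None \<noteq> 0"
      using isotropic_None_nonzero nz 3 norm by metis+
    \<comment> \<open>This is the standard definite product. For the pairs used below
      \<open>hform z w = 0\<close>, so only the negative coordinates survive.\<close>
    have J: "hform z (Jmat *v w) = hform z w + 2 * (q_cnj (w $ None) * z $ None)" for z w :: "'n hvec"
      by (simp add: hform_option Jmat_nth mult_2 q_cnj_minus)
    have two: "(2::quat) \<noteq> 0"
      by simp
    have cnj_nz: "q_cnj x \<noteq> 0" if "x \<noteq> 0" for x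
      using that by (metis q_cnj_cnj q_cnj_0)
    show thesis
    proof (rule two_steps[of "Jmat *v y"])
      show "hform (Jmat *v y) (Jmat *v y) = hform y y"
        by (simp add: hform_Jmat Jmat_Jmat)
      \<comment> \<open>Because \<open>Jmat *v e = e\<close>, moving \<open>Jmat\<close> across the
        form keeps orthogonality to \<open>e\<close>.\<close>
      show "hform e (Jmat *v y) = 0"
        using e orth' by (simp flip: hform_Jmat)
      show "hform (Jmat *v y) y \<noteq> hform y y"
        using N 3 two cnj_nz by (simp add: hform_Jmat J)
      show "hform y' (Jmat *v y) \<noteq> hform y y"
        using N 3 two cnj_nz by (simp add: J)
    qed
  qed
qed

section \<open>Topology of the space of pairs\<close>

text \<open>A product of quotient maps need not be a quotient map; openness does pass to products
  and supplies the quotient property for pairs of points.\<close>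

lemma open_map_prod_topology:
  assumes f: "open_map X X' f" and g: "open_map Y Y' g"
  shows "open_map (prod_topology X Y) (prod_topology X' Y') (\<lambda>(x, y). (f x, g y))"
  unfolding open_map_def
proof (intro allI impI)
  fix W assume W: "openin (prod_topology X Y) W"
  show "openin (prod_topology X' Y') ((\<lambda>(x, y). (f x, g y)) ` W)"
    unfolding openin_prod_topology_alt
  proof (intro allI impI)
    fix x' y' assume "(x', y') \<in> (\<lambda>(x, y). (f x, g y)) ` W"
    then obtain x y where xy: "(x, y) \<in> W" "x' = f x" "y' = g y"
      by auto
    then obtain U V where UV: "openin X U" "openin Y V" "x \<in> U" "y \<in> V" "U \<times> V \<subseteq> W"
      using W unfolding openin_prod_topology_alt by metis
    then show "\<exists>U' V'. openin X' U' \<and> openin Y' V' \<and> x' \<in> U' \<and> y' \<in> V' \<and>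
        U' \<times> V' \<subseteq> (\<lambda>(x, y). (f x, g y)) ` W"
      using f g xy by (intro exI[of _ "f ` U"] exI[of _ "g ` V"]) (auto simp: open_map_def)
  qed
qed

text \<open>\<open>F\<close> descends to the quotient with inverse \<open>P \<circ> s\<close>:
  \<open>s (F x)\<close> and \<open>x\<close> have the same value of \<open>F\<close>, hence of
  \<open>P\<close>.\<close>

lemma quotient_homeomorphic_if_section:
  assumes F: "continuous_map X Y F" and s: "continuous_map Y X s"
    and sect: "\<And>y. y \<in> topspace Y \<Longrightarrow> F (s y) = y"
    and fib: "\<And>x x'. \<lbrakk>x \<in> topspace X; x' \<in> topspace X\<rbrakk> \<Longrightarrow> P x = P x' \<longleftrightarrow> F x = F x'"
  shows "quotient_topology X P homeomorphic_space Y"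
proof -
  have P: "quotient_map X (quotient_topology X P) P"
    by (rule quotient_map_quotient_topology)
  then obtain h where h: "continuous_map (quotient_topology X P) Y h"
    "\<And>x. x \<in> topspace X \<Longrightarrow> h (P x) = F x"
    using quotient_map_lift_exists[OF P F] fib by metis
  have "continuous_map Y (quotient_topology X P) (P \<circ> s)"
    using s P continuous_map_compose quotient_imp_continuous_map by blast
  moreover have "s y \<in> topspace X" if "y \<in> topspace Y" for y
    using s that by (auto simp: continuous_map_def)
  moreover have "F x \<in> topspace Y" if "x \<in> topspace X" for x
    using F that by (auto simp: continuous_map_def)
  ultimately have "homeomorphic_maps (quotient_topology X P) Y h (P \<circ> s)"
    unfolding homeomorphic_maps_def using h sect fib by auto
  then show ?thesis
    by (auto simp: homeomorphic_space_def)
qed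

section \<open>Representatives of projective points\<close>

lemma self_in_proj: "z \<in> proj z"
  by (auto simp: proj_def intro!: exI[of _ 1])

lemma proj_rscale: "q \<noteq> 0 \<Longrightarrow> proj (rscale z q) = proj z"
proof -
  assume q: "q \<noteq> 0"
  have "\<exists>q'. rscale z p = rscale z (q * q') \<and> q' \<noteq> 0" if "p \<noteq> 0" for p
    using that q by (intro exI[of _ "inverse q * p"]) (simp flip: mult.assoc)
  with q show ?thesis
    by (auto simp: proj_def) 
qed

lemma proj_eq_iff: "proj z = proj w \<longleftrightarrow> (\<exists>q. q \<noteq> 0 \<and> w = rscale z q)"
proof
  assume "proj z = proj w"
  with self_in_proj[of w] have "w \<in> proj z"
    by simp
  then show "\<exists>q. q \<noteq> 0 \<and> w = rscale z q"
    by (auto simp: proj_def)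
qed (auto simp: proj_rscale)

lemma proj_mult_eq: "proj x = proj y \<Longrightarrow> proj (g *v x) = proj (g *v y)"
  by (metis image_proj)

lemma V_plus_iff: "z \<in> V_plus \<longleftrightarrow> q_re (hform z z) > 0"
  unfolding V_plus_def using hform_self[of z] by force

lemma V_plus_nonzero: "z \<in> V_plus \<Longrightarrow> z \<noteq> 0"
  by (auto simp: V_plus_iff)

lemma hform_rscale_self:
  "hform (rscale z p) (rscale z p) = of_real (inner p p * q_re (hform z z))"
proof -
  obtain r where "hform z z = of_real r"
    using hform_self by blast
  then show ?thesis
    by (simp add: hform_linear) (metis cnj_mult_self(1) mult.assoc of_real_commute_quat)
qed

lemma q_re_hform_rscale_self:
  "q_re (hform (rscale z p) (rscale z p)) = inner p p * q_re (hform z z)"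
  unfolding hform_rscale_self by (simp only: quat_of_real_simps)

lemma V_plus_rscale: "q \<noteq> 0 \<Longrightarrow> rscale z q \<in> V_plus \<longleftrightarrow> z \<in> V_plus"
  by (simp add: V_plus_iff q_re_hform_rscale_self zero_less_mult_iff not_less
      flip: power2_norm_eq_inner)

lemma proj_in_PV_plus: "proj z \<in> proj ` V_plus \<longleftrightarrow> z \<in> V_plus"
proof
  assume "proj z \<in> proj ` V_plus"
  then obtain w where "w \<in> V_plus" "proj z = proj w"
    by auto
  then show "z \<in> V_plus"
    unfolding proj_eq_iff using V_plus_rscale by blast
qed simp

lemma continuous_on_hform [continuous_intros]:
  "continuous_on S f \<Longrightarrow> continuous_on S g \<Longrightarrow> continuous_on S (\<lambda>x. hform (f x) (g x))"
  unfolding hform_option by (intro continuous_intros)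

lemma continuous_on_rscale [continuous_intros]:
  "continuous_on S f \<Longrightarrow> continuous_on S (\<lambda>x. rscale (f x) q)"
  unfolding rscale_def by (intro continuous_intros)

text \<open>The saturation of an open set is the union of its preimages under the nonzero right
  scalings, which are continuous.\<close>

lemma open_map_proj: "open_map (top_of_set (- {0})) (HP_top T) proj"
  unfolding open_map_def
proof (intro allI impI)
  fix U :: "'a hvec set" assume U: "openin (top_of_set (- {0})) U"
  then have oU: "open U" and U0: "U \<subseteq> - {0}"
    by (auto simp: openin_open)
  have "{x \<in> - {0}. proj x \<in> proj ` U} = (\<Union>q\<in>-{0}. (\<lambda>x. rscale x q) -` U)"
    using U0 by (auto simp: image_iff proj_eq_iff)
  moreover have "open (\<Union>q\<in>-{0}. (\<lambda>x. rscale x q) -` U)"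
    by (intro open_UN ballI open_vimage oU continuous_intros)
  ultimately have "openin (top_of_set (- {0})) {x \<in> - {0}. proj x \<in> proj ` U}"
    by (metis (no_types, lifting) mem_Collect_eq open_subset subsetI)
  with U0 show "openin (HP_top T) (proj ` U)"
    by (auto simp: HP_top_def openin_quotient_topology)
qed

lemma continuous_map_proj: "continuous_map (top_of_set (- {0})) (HP_top T) proj"
  unfolding HP_top_def using quotient_map_quotient_topology by (rule quotient_imp_continuous_map)

lemma topspace_PV_plus_top: "topspace (PV_plus_top T) = proj ` V_plus"
  using V_plus_nonzero by (auto simp: PV_plus_top_def HP_top_def)

text \<open>\<open>V_plus\<close> is a union of full fibres of \<open>proj\<close>, so openness
  survives the restriction.\<close>

lemma proj_V_plus:
  "continuous_map (top_of_set V_plus) (PV_plus_top T) proj"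
  "open_map (top_of_set V_plus) (PV_plus_top T) proj"
proof -
  have nz: "V_plus \<subseteq> - {0}"
    using V_plus_nonzero by blast
  then have pre: "{x \<in> topspace (top_of_set (- {0})). proj x \<in> proj ` V_plus} = V_plus"
    by (auto simp: proj_in_PV_plus)
  have sub: "subtopology (top_of_set (- {0})) V_plus = top_of_set V_plus"
    by (simp only: subtopology_subtopology Int_absorb1[OF nz])
  show "open_map (top_of_set V_plus) (PV_plus_top T) proj"
    using open_map_restriction[OF open_map_proj pre] unfolding sub PV_plus_top_def .
  show "continuous_map (top_of_set V_plus) (PV_plus_top T) proj"
    unfolding PV_plus_top_def
    by (rule continuous_map_into_subtopology)
      (use continuous_map_from_subtopology[OF continuous_map_proj, of V_plus] in \<open>auto simp: sub\<close>)
qed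

section \<open>The invariant of a pair of positive points\<close>

definition pair_inv :: "'n::finite hvec \<Rightarrow> 'n hvec \<Rightarrow> real" where
  "pair_inv z w = (norm (hform z w))\<^sup>2 / (q_re (hform z z) * q_re (hform w w))"

lemma pair_inv_rscale:
  "p \<noteq> 0 \<Longrightarrow> q \<noteq> 0 \<Longrightarrow> pair_inv (rscale z p) (rscale w q) = pair_inv z w"
  unfolding pair_inv_def q_re_hform_rscale_self
  by (simp add: hform_linear norm_mult power_mult_distrib field_simps flip: power2_norm_eq_inner)

lemma pair_inv_Sp: "g \<in> carrier (Sp T) \<Longrightarrow> pair_inv (g *v z) (g *v w) = pair_inv z w"
  by (simp add: pair_inv_def hform_Sp)

lemma pair_inv_nonneg: "z \<in> V_plus \<Longrightarrow> w \<in> V_plus \<Longrightarrow> 0 \<le> pair_inv z w"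
  by (simp add: pair_inv_def V_plus_iff)

text \<open>The choice is harmless on projective points: representatives differ by nonzero right
  scalars, which leave \<open>pair_inv\<close> unchanged.\<close>

definition config_inv :: "'n::finite hvec set \<times> 'n hvec set \<Rightarrow> real" where
  "config_inv = (\<lambda>(p, q). pair_inv (SOME z. z \<in> p) (SOME w. w \<in> q))"

lemma config_inv_proj: "config_inv (proj z, proj w) = pair_inv z w"
proof -
  have "\<exists>q. q \<noteq> 0 \<and> (SOME x. x \<in> proj z) = rscale z q" for z :: "'a hvec"
    using someI[of "\<lambda>x. x \<in> proj z", OF self_in_proj] by (auto simp: proj_def)
  then obtain p q where "p \<noteq> 0" "(SOME x. x \<in> proj z) = rscale z p"
    "q \<noteq> 0" "(SOME x. x \<in> proj w) = rscale w q"
    by meson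
  then show ?thesis
    by (simp add: config_inv_def pair_inv_rscale)
qed

lemma topspace_pairs_top:
  "topspace (pairs_top T) = {(proj z, proj w) |z w. z \<in> V_plus \<and> w \<in> V_plus \<and> proj z \<noteq> proj w}"
  by (auto simp: pairs_top_def topspace_PV_plus_top)

text \<open>Continuity is checked on vectors and descends along the open projection. The diagonal is
  removed only afterwards, so the quotient map is a plain product.\<close>

lemma continuous_map_config_inv: "continuous_map (pairs_top T) (top_of_set {0..}) config_inv"
proof -
  let ?X = "prod_topology (top_of_set V_plus) (top_of_set (V_plus :: 'a hvec set))"
  let ?Y = "prod_topology (PV_plus_top T) (PV_plus_top T)"
  let ?pp = "\<lambda>(z :: 'a hvec, w :: 'a hvec). (proj z, proj w)"
  have cont: "continuous_map ?X ?Y ?pp"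
    using continuous_map_prod_top proj_V_plus(1) by blast
  have "quotient_map ?X ?Y ?pp"
    by (rule continuous_open_imp_quotient_map[OF cont open_map_prod_topology])
      (auto simp: proj_V_plus topspace_PV_plus_top image_iff)
  moreover have "continuous_map ?X euclideanreal (config_inv \<circ> ?pp)"
  proof -
    have "continuous_on (V_plus \<times> V_plus) (\<lambda>x :: 'a hvec \<times> 'a hvec. pair_inv (fst x) (snd x))"
      unfolding pair_inv_def by (intro continuous_intros) (auto simp: V_plus_iff)
    moreover have "config_inv \<circ> ?pp = (\<lambda>x. pair_inv (fst x) (snd x))"
      by (auto simp: config_inv_proj)
    ultimately show ?thesis
      by (simp del: o_apply add: prod_topology_subtopology_eu)
  qed
  ultimately have "continuous_map ?Y euclideanreal config_inv"
    by (rule continuous_compose_quotient_map)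
  then have "continuous_map (pairs_top T) euclideanreal config_inv"
    unfolding pairs_top_def by (rule continuous_map_from_subtopology)
  then show ?thesis
    by (rule continuous_map_into_subtopology)
      (auto simp: topspace_pairs_top config_inv_proj pair_inv_nonneg)
qed

section \<open>Orbits and the invariant\<close>

lemma continuous_on_axis [continuous_intros]:
  "continuous_on S f \<Longrightarrow> continuous_on S (\<lambda>x. axis k (f x))"
  for f :: "'a::topological_space \<Rightarrow> 'b::{topological_space,zero}"
  unfolding axis_def by (intro continuous_on_vec_lambda) (rename_tac i, case_tac "i = k", simp_all)

text \<open>Polar form of a quaternion, used to make the product of the second vector with
  \<open>e\<close> real and nonnegative.\<close>

lemma unit_phase:
  fixes c :: quat
  obtains u where "norm u = 1" "c * u = of_real (norm c)"
proof (cases "c = 0")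
  case True
  with that[of 1] show thesis by simp
next
  case False
  have "c * (q_cnj c /\<^sub>R norm c) = of_real (inverse (norm c) * (norm c * norm c))"
    unfolding mult_scaleR_right cnj_mult_self power2_norm_eq_inner[symmetric] power2_eq_square
    by (simp only: scaleR_conv_of_real of_real_mult)
  also have "\<dots> = of_real (norm c)"
    using False by (simp only: flip: mult.assoc) simp
  finally have "c * (q_cnj c /\<^sub>R norm c) = of_real (norm c)" .
  with False that[of "q_cnj c /\<^sub>R norm c"] show thesis
    by simp
qed

lemma normalizing_factor:
  assumes "z \<in> V_plus"
  obtains c where "c > 0" "c * c * q_re (hform z z) = 1"
  using assms that[of "1 / sqrt (q_re (hform z z))"] by (simp add: V_plus_iff)

text \<open>The target \<open>(e, w0)\<close> is tied to the source only through the invariant, so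
  it serves as a common normal form for all pairs with the same value.\<close>

lemma Sp_transitive:
  fixes z w e w0 :: "'n::finite hvec"
  assumes z: "z \<in> V_plus" and w: "w \<in> V_plus" and ne: "proj z \<noteq> proj w"
    and e: "Jmat *v e = e" "hform e e = 1"
    and w0: "hform w0 w0 = 1" "hform w0 e = of_real (sqrt (pair_inv z w))" "proj e \<noteq> proj w0"
  obtains g where "g \<in> carrier (Sp TYPE('n))" "proj (g *v z) = proj e" "proj (g *v w) = proj w0"
proof -
  interpret Sp: group "Sp TYPE('n)"
    by (rule group_Sp)
  obtain b where b: "b > 0" "b * b * q_re (hform z z) = 1"
    using z by (rule normalizing_factor)
  define z1 where "z1 = rscale z (of_real b)"
  have "hform z1 z1 = of_real (b * b * q_re (hform z z))"
    unfolding z1_def hform_rscale_self by (simp add: inner_quat_def)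
  then have z1: "hform z1 z1 = 1" "proj z1 = proj z"
    using b proj_rscale[of "of_real b" z] by (simp_all add: z1_def)
  have nz: "z1 \<noteq> 0" "e \<noteq> 0"
    using z1 e by auto
  obtain g where g: "g \<in> carrier (Sp TYPE('n))" "g *v z1 = e"
    by (rule witt_fixing[of z1 e 0]) (simp_all add: z1 e nz)
  define r where "r = q_re (hform w w)"
  obtain c where c: "c > 0" "c * c * r = 1"
    using w unfolding r_def by (rule normalizing_factor)
  define s where "s = sqrt (pair_inv z w)"
  define N where "N = norm (hform (g *v w) e)"
  have r: "r \<noteq> 0" and N: "N \<ge> 0"
    using c(2) by (auto simp: N_def)
  \<comment> \<open>The invariant survives rescaling and \<open>g\<close>; computed on
    \<open>e\<close> and \<open>g *v w\<close>, it identifies \<open>s\<close> with the modulus of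
    the normalised product.\<close>
  have "pair_inv z w = pair_inv z1 w"
    using pair_inv_rscale[of "of_real b" 1 z w] b by (simp add: z1_def)
  also have "\<dots> = pair_inv e (g *v w)"
    using pair_inv_Sp[OF g(1), of z1 w] by (simp only: g)
  also have "\<dots> = N\<^sup>2 / r"
  proof -
    have "norm (hform e (g *v w)) = N"
      unfolding N_def hform_cnj[of "g *v w" e, symmetric] by simp
    then show ?thesis
      unfolding pair_inv_def hform_Sp[OF g(1)] by (simp add: e(2) r_def)
  qed
  also have "\<dots> = N\<^sup>2 * (c * c * r) / r"
    using c by simp
  also have "\<dots> = (c * N)\<^sup>2"
    using r by (simp add: power2_eq_square)
  finally have s: "s = c * N"
    using c(1) N unfolding s_def by simp
  obtain u where u: "norm u = 1" "hform (g *v w) e * u = of_real N"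
    unfolding N_def by (rule unit_phase[of "hform (g *v w) e"])
  \<comment> \<open>The factor \<open>u\<close> corrects the phase of the product with
    \<open>e\<close>, and \<open>c\<close> the norm.\<close>
  define w2 where "w2 = rscale (g *v w) (u * of_real c)"
  have "u * of_real c \<noteq> 0"
    using u c by auto
  then have w2: "proj w2 = proj (g *v w)"
    unfolding w2_def by (rule proj_rscale)
  have "hform w2 e = hform (g *v w) e * u * of_real c"
    by (simp add: w2_def hform_linear mult.assoc)
  then have hw2_e: "hform w2 e = of_real s"
    by (simp add: u s mult.commute)
  have "inner (u * of_real c) (u * of_real c) = c * c"
    using u(1) by (simp add: norm_mult power2_eq_square flip: power2_norm_eq_inner)
  then have hw2: "hform w2 w2 = 1"
    unfolding w2_def hform_rscale_self hform_Sp[OF g(1)] r_def[symmetric] by (simp only: c of_real_1)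
  have ne2: "proj e \<noteq> proj w2"
  proof
    assume "proj e = proj w2"
    obtain g' where g': "g' ** g = mat 1"
      using g(1) by (auto simp: Sp_def invertible_def)
    have "proj (g' *v (g *v z1)) = proj (g' *v (g *v w))"
      by (rule proj_mult_eq) (simp add: g \<open>proj e = proj w2\<close> w2)
    then have "proj z1 = proj w"
      by (simp add: matrix_vector_mul_assoc g')
    with ne z1 show False by simp
  qed
  \<comment> \<open>The component orthogonal to \<open>e\<close>. For \<open>w2\<close> and
    \<open>w0\<close> its norm is \<open>1 - s * s\<close>, of either sign; even when this is 0 the
    component is nonzero, since the points are distinct from that of \<open>e\<close>.\<close>
  define d where "d = (\<lambda>x. x - rscale e (of_real s))"
  have d: "hform (d x) (d x) = of_real (1 - s * s)" "hform (d x) e = 0" "d x \<noteq> 0"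
    if "hform x e = of_real s" "hform x x = 1" "proj e \<noteq> proj x" for x
  proof -
    have ex: "hform e x = of_real s"
      using hform_cnj[of x e] that by simp
    show "hform (d x) (d x) = of_real (1 - s * s)" "hform (d x) e = 0"
      unfolding d_def by (simp_all add: hform_linear that ex e)
    show "d x \<noteq> 0"
    proof
      assume "d x = 0"
      then have "x = rscale e (of_real s)"
        by (simp add: d_def)
      then show False
        using that proj_rscale[of "of_real s" e] by (cases "s = 0") auto
    qed
  qed
  have hw0: "hform w0 e = of_real s"
    using w0 by (simp add: s_def)
  obtain h where h: "h \<in> carrier (Sp TYPE('n))" "h *v d w2 = d w0" "h *v e = e"
    by (rule witt_fixing[of "d w2" "d w0" e])
      (simp_all only: d[OF hw2_e hw2 ne2] d[OF hw0 w0(1,3)] e not_False_eq_True)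
  \<comment> \<open>Both \<open>w2\<close> and \<open>w0\<close> have the component
    \<open>rscale e (of_real s)\<close> along \<open>e\<close>, which \<open>h\<close>
    fixes.\<close>
  have "h *v w2 = h *v d w2 + h *v rscale e (of_real s)"
    by (simp add: d_def flip: matrix_vector_right_distrib)
  also have "\<dots> = w0"
    by (simp add: h mult_rscale) (simp add: d_def)
  finally have "proj (h *v (g *v w)) = proj w0"
    using proj_mult_eq[OF w2] by metis
  moreover have "proj (h *v (g *v z)) = proj e"
    using proj_mult_eq[OF proj_mult_eq[OF z1(2)]] g h by metis
  moreover have "h ** g \<in> carrier (Sp TYPE('n))"
    using Sp.m_closed[OF h(1) g(1)] by (simp add: Sp_def)
  ultimately show thesis
    using that[of "h ** g"] by (simp add: matrix_vector_mul_assoc)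
qed

text \<open>Cosets act through any representative, so later arguments use matrices alone.\<close>

lemma orbit_PSp_proj:
  "orbit (PSp TYPE('n::finite)) PSp_act2 (proj z, proj w) =
    {(proj (g *v z), proj (g *v w)) |g. g \<in> carrier (Sp TYPE('n))}"
proof -
  have carrier: "carrier (PSp TYPE('n)) =
      (\<lambda>g. {mat 1, - mat 1} #>\<^bsub>Sp TYPE('n)\<^esub> g) ` carrier (Sp TYPE('n))"
    unfolding PSp_def FactGroup_def RCOSETS_def by auto
  show ?thesis
    unfolding orbit_def carrier Setcompr_eq_image Collect_mem_eq image_image
    by (rule image_cong) (simp_all add: PSp_act2_def PSp_act_coset)
qed

text \<open>Replacing \<open>k\<close> by \<open>k ** h\<close> translates one parametrisation into
  the other; equality of orbits comes from two such inclusions.\<close>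

lemma orbit_PSp_subset:
  fixes z w z' w' :: "'n::finite hvec"
  assumes h: "h \<in> carrier (Sp TYPE('n))" and "proj z = proj (h *v z')" "proj w = proj (h *v w')"
  shows "orbit (PSp TYPE('n)) PSp_act2 (proj z, proj w) \<subseteq> orbit (PSp TYPE('n)) PSp_act2 (proj z', proj w')"
proof -
  have "k ** h \<in> carrier (Sp TYPE('n))" if "k \<in> carrier (Sp TYPE('n))" for k
    using monoid.m_closed[OF group.is_monoid[OF group_Sp] that h] by (simp add: Sp_def)
  moreover have "proj (k *v z) = proj ((k ** h) *v z')" "proj (k *v w) = proj ((k ** h) *v w')"
    for k :: "'n hmat"
    using proj_mult_eq[OF assms(2), of k] proj_mult_eq[OF assms(3), of k]
    by (simp_all add: matrix_vector_mul_assoc)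
  ultimately show ?thesis
    unfolding orbit_PSp_proj by auto
qed

section \<open>An explicit continuous family of pairs, one for each value of the invariant\<close>

lemma quadratic_pos: "t\<^sup>2 - t + 1 > (0::real)"
proof -
  have "t\<^sup>2 - t + 1 = (t - 1 / 2)\<^sup>2 + 3 / 4"
    by (simp add: power2_eq_square algebra_simps)
  then show ?thesis
    by (simp add: add_nonneg_pos)
qed

lemma hform_axis: "hform x (axis k a) = q_cnj a * (Jmat *v x) $ k"
  by (simp add: hform_def axis_def if_distrib[of q_cnj] if_distrib[of "\<lambda>x. x * _"] cong: if_cong)

text \<open>The hypothesis \<open>n \<ge> 2\<close> enters through this locale: values of the
  invariant up to 1 require a second positive direction.\<close>

locale two_positive_axes =
  fixes i j :: "'n::finite"
  assumes ij: "i \<noteq> j"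
begin

definition base_vec :: "'n hvec" where
  "base_vec = axis (Some i) 1"

text \<open>
  Any coordinates \<open>(\<surd>t, b, c)\<close> with \<open>b\<^sup>2 - c\<^sup>2 = 1 - t\<close> give a vector of norm 1; \<open>c = t\<close> keeps
  \<open>b\<close> real and nonzero, so that the pair also stays distinct in the degenerate case \<open>t = 1\<close>.
\<close>

definition moving_vec :: "real \<Rightarrow> 'n hvec" where
  "moving_vec t = axis (Some i) (of_real (sqrt t)) + axis (Some j) (of_real (sqrt (t\<^sup>2 - t + 1)))
    + axis None (of_real t)"

lemma base_vec: "Jmat *v base_vec = base_vec" "hform base_vec base_vec = 1" "base_vec \<in> V_plus"
proof -
  show J: "Jmat *v base_vec = base_vec"
    by (auto simp: base_vec_def vec_eq_iff Jmat_nth axis_def)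
  show "hform base_vec base_vec = 1"
    by (subst (2) base_vec_def) (simp add: hform_axis J, simp add: base_vec_def)
  then show "base_vec \<in> V_plus"
    by (simp add: V_plus_iff)
qed

lemma moving_vec:
  assumes "t \<ge> 0"
  shows "hform (moving_vec t) (moving_vec t) = 1" "hform (moving_vec t) base_vec = of_real (sqrt t)"
    "proj base_vec \<noteq> proj (moving_vec t)"
proof -
  have nth: "moving_vec t $ Some i = of_real (sqrt t)" "moving_vec t $ Some j = of_real (sqrt (t\<^sup>2 - t + 1))"
    "moving_vec t $ None = of_real t"
    using ij by (auto simp: moving_vec_def axis_def)
  show "hform (moving_vec t) base_vec = of_real (sqrt t)"
    by (simp add: base_vec_def hform_axis Jmat_nth nth)
  have "hform (moving_vec t) (moving_vec t) =
      of_real (sqrt t * sqrt t + sqrt (t\<^sup>2 - t + 1) * sqrt (t\<^sup>2 - t + 1) - t * t)"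
    \<comment> \<open>Only the second argument is expanded, so each axis reads off one coordinate of
      the first.\<close>
    by (subst (2) moving_vec_def) (simp add: hform_linear hform_axis Jmat_nth nth del: real_sqrt_mult_self)
  also have "\<dots> = 1"
    using assms quadratic_pos[of t] by (simp add: power2_eq_square)
  finally show "hform (moving_vec t) (moving_vec t) = 1" .
  have "moving_vec t $ Some j \<noteq> 0"
    using quadratic_pos[of t] by (simp add: nth)
  moreover have "rscale base_vec q $ Some j = 0" for q
    using ij by (simp add: base_vec_def rscale_def axis_def)
  ultimately show "proj base_vec \<noteq> proj (moving_vec t)"
    unfolding proj_eq_iff by metis
qed

lemma moving_vec_V_plus: "t \<ge> 0 \<Longrightarrow> moving_vec t \<in> V_plus"
  by (simp add: V_plus_iff moving_vec)

lemma config_inv_section: "t \<ge> 0 \<Longrightarrow> config_inv (proj base_vec, proj (moving_vec t)) = t"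
proof -
  assume t: "t \<ge> 0"
  have "hform base_vec (moving_vec t) = of_real (sqrt t)"
    using hform_cnj[of "moving_vec t" base_vec] moving_vec(2)[OF t] by (metis q_cnj_of_real)
  then show ?thesis
    using t by (simp add: config_inv_proj pair_inv_def base_vec moving_vec)
qed

lemma continuous_map_section:
  "continuous_map (top_of_set {0..}) (pairs_top TYPE('n)) (\<lambda>t. (proj base_vec, proj (moving_vec t)))"
proof -
  have "continuous_on {0..} moving_vec"
    unfolding moving_vec_def by (intro continuous_intros)
  then have "continuous_map (top_of_set {0..}) (top_of_set V_plus) moving_vec"
    using moving_vec_V_plus by (auto simp: continuous_map_in_subtopology)
  from continuous_map_compose[OF this proj_V_plus(1)]
  have "continuous_map (top_of_set {0..}) (PV_plus_top TYPE('n)) (\<lambda>t. proj (moving_vec t))"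
    by (simp add: o_def)
  then show ?thesis
    unfolding pairs_top_def using base_vec moving_vec
    by (intro continuous_map_into_subtopology continuous_map_pairedI)
      (auto simp: topspace_PV_plus_top)
qed

text \<open>Isometries preserve the invariant; conversely, pairs with equal invariants are moved to
  the same pair of \<open>base_vec\<close> and \<open>moving_vec\<close>.\<close>

lemma orbit_eq_iff:
  assumes "x \<in> topspace (pairs_top TYPE('n))" "x' \<in> topspace (pairs_top TYPE('n))"
  shows "orbit (PSp TYPE('n)) PSp_act2 x = orbit (PSp TYPE('n)) PSp_act2 x'
    \<longleftrightarrow> config_inv x = config_inv x'"
proof -
  interpret Sp: group "Sp TYPE('n)"
    by (rule group_Sp)
  obtain z w where x: "x = (proj z, proj w)" and zw: "z \<in> V_plus" "w \<in> V_plus" "proj z \<noteq> proj w"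
    using assms(1) by (auto simp: topspace_pairs_top)
  obtain z' w' where x': "x' = (proj z', proj w')"
    and zw': "z' \<in> V_plus" "w' \<in> V_plus" "proj z' \<noteq> proj w'"
    using assms(2) by (auto simp: topspace_pairs_top)
  show ?thesis
  proof
    assume "orbit (PSp TYPE('n)) PSp_act2 x = orbit (PSp TYPE('n)) PSp_act2 x'"
    moreover have "x \<in> orbit (PSp TYPE('n)) PSp_act2 x"
      using Sp.one_closed unfolding x orbit_PSp_proj
      by (auto intro!: exI[of _ "mat 1"] simp: Sp_def)
    ultimately obtain g where "g \<in> carrier (Sp TYPE('n))" "x = (proj (g *v z'), proj (g *v w'))"
      unfolding x' orbit_PSp_proj by auto
    then show "config_inv x = config_inv x'"
      by (simp add: x' config_inv_proj pair_inv_Sp)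
  next
    assume eq: "config_inv x = config_inv x'"
    have sub: "orbit (PSp TYPE('n)) PSp_act2 (proj z, proj w)
        \<subseteq> orbit (PSp TYPE('n)) PSp_act2 (proj z', proj w')"
      if zw: "z \<in> V_plus" "w \<in> V_plus" "proj z \<noteq> proj w"
        and zw': "z' \<in> V_plus" "w' \<in> V_plus" "proj z' \<noteq> proj w'"
        and eq: "pair_inv z w = pair_inv z' w'" for z w z' w' :: "'n hvec"
    proof -
      have t: "pair_inv z w \<ge> 0"
        using zw by (simp add: pair_inv_nonneg)
      obtain g where g: "g \<in> carrier (Sp TYPE('n))"
        "proj (g *v z) = proj base_vec" "proj (g *v w) = proj (moving_vec (pair_inv z w))"
        by (rule Sp_transitive[OF zw base_vec(1,2) moving_vec[OF t]])
      obtain g' where g': "g' \<in> carrier (Sp TYPE('n))"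
        "proj (g' *v z') = proj base_vec" "proj (g' *v w') = proj (moving_vec (pair_inv z w))"
        by (rule Sp_transitive[OF zw' base_vec(1,2) moving_vec[OF t, unfolded eq]]) (simp add: eq)
      \<comment> \<open>Through the common normal form, \<open>h ** g'\<close> carries the second
        pair to the first.\<close>
      define h where "h = inv\<^bsub>Sp TYPE('n)\<^esub> g"
      have h: "h \<in> carrier (Sp TYPE('n))" "h \<otimes>\<^bsub>Sp TYPE('n)\<^esub> g = \<one>\<^bsub>Sp TYPE('n)\<^esub>"
        using g by (simp_all add: h_def)
      then have hg: "h ** g = mat 1"
        by (simp add: Sp_def)
      have eqI: "proj x = proj ((h ** g') *v x')" if "proj (g *v x) = proj (g' *v x')" for x x'
        using proj_mult_eq[OF that, of h] hg by (simp add: matrix_vector_mul_assoc)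
      have "h ** g' \<in> carrier (Sp TYPE('n))"
        using Sp.m_closed[OF h(1) g'(1)] by (simp add: Sp_def)
      then show ?thesis
        by (rule orbit_PSp_subset) (rule eqI; simp add: g g')+
    qed
    show "orbit (PSp TYPE('n)) PSp_act2 x = orbit (PSp TYPE('n)) PSp_act2 x'"
      using sub[OF zw zw'] sub[OF zw' zw] eq by (simp add: x x' config_inv_proj)
  qed
qed

end

theorem theorem4p2:
  assumes "CARD('n::finite) \<ge> 2"
  shows "config_top TYPE('n) homeomorphic_space top_of_set {t::real. t \<ge> 0}"
proof -
  obtain i j :: 'n where "i \<noteq> j"
    using assms by (metis (full_types) One_nat_def Suc_1 card_2_iff' ex_card)
  then interpret two_positive_axes i j
    by unfold_locales
  have "config_top TYPE('n) homeomorphic_space top_of_set {0::real..}"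
    unfolding config_top_def
    by (rule quotient_homeomorphic_if_section[OF continuous_map_config_inv continuous_map_section])
      (simp_all add: config_inv_section orbit_eq_iff)
  then show ?thesis
    by (simp add: atLeast_def)
qed

end
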